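(* Let $\varphi\colon\mathbb{T}^+\times X\to X$ be a dynamical system on a compact metric space $X$, let $\mathcal{X}$ be a finite set, let $|\cdot|\colon\mathsf{Set}(\mathcal{X})\to\mathscr{R}(X)$ be a homomorphism of bounded lattices from the power set of $\mathcal{X}$ to the regular closed subsets of $X$, and let $\mathcal{F}\subset\mathcal{X}\times\mathcal{X}$ be a (finite) binary relation. Consider the diagram with top row $\mathscr{R}(X)\supset\mathsf{ABlock}_{\mathscr{R}}(\varphi)\xrightarrow{\ \omega\ }\mathsf{Att}(\varphi)$, bottom row $\mathsf{Set}(\mathcal{X})\supset\mathsf{Invset}^+(\mathcal{F})\xrightarrow{\ \boldsymbol{\omega}\ }\mathsf{Att}(\mathcal{F})$, and vertical homomorphisms from the bottom row to the top row given by $|\cdot|$, the restriction of $|\cdot|$, and $c\colon\mathsf{Att}(\mathcal{F})\to\mathsf{Att}(\varphi)$. This diagram commutes (that is, $|\mathcal{U}|\in\mathsf{ABlock}_{\mathscr{R}}(\varphi)$ for all $\mathcal{U}\in\mathsf{Invset}^+(\mathcal{F})$, and there is a lattice homomorphism $c$ with $c(\boldsymbol{\omega}(\mathcal{U}))=\omega(|\mathcal{U}|)$ for all $\mathcal{U}\in\mathsf{Invset}^+(\mathcal{F})$) if and only if $\mathcal{F}$ satisfies both (W) $\varphi(t,|\xi|)\subset\mathrm{int}\,|\Gamma^+(\xi)|$ for all $\xi\in\mathcal{X}$ and all $t>0$; and (L) $\omega(|\xi|)\subset|\boldsymbol{\omega}(\xi)|$ for all $\xi\in\mathcal{X}$.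 In this case $c(\mathcal{A})=\omega(|\mathcal{A}|)$ for all $\mathcal{A}\in\mathsf{Att}(\mathcal{F})$.
   Context: $\mathbb{T}$ is $\mathbb{Z}$ or $\mathbb{R}$, $\mathbb{T}^+=\{t\in\mathbb T\mid t\ge0\}$; a dynamical system is a continuous $\varphi\colon\mathbb{T}^+\times X\to X$ with $\varphi(0,x)=x$, $\varphi(t,\varphi(s,x))=\varphi(t+s,x)$. $\omega(U)=\bigcap_{t\ge0}\mathrm{cl}\bigcup_{s\ge t}\varphi(s,U)$. Lattices are bounded; homomorphisms preserve $0,1$. $\mathscr{R}(X)$ is the Boolean algebra of regular closed sets ($U=\mathrm{cl}\,\mathrm{int}\,U$) with $U\vee U'=U\cup U'$, $U\wedge U'=\mathrm{cl}\,\mathrm{int}(U\cap U')$, complement $\mathrm{cl}(U^c)$. $\mathsf{ABlock}_{\mathscr{R}}(\varphi)$ is the sublattice of those $U\in\mathscr{R}(X)$ that are attracting blocks: $\varphi(t,\mathrm{cl}\,U)\subset\mathrm{int}\,U$ for all $t>0$. $\mathsf{Att}(\varphi)$ is the lattice of attractors (sets $A$ with an open neighborhood $U$ such that $\omega(U)=A$), with $A\vee A'=A\cup A'$ and $A\wedge A'=\omega(A\cap A')$. For the relation: $\mathcal{F}(\mathcal{U})=\bigcup_{\xi\in\mathcal{U}}\{\eta\mid(\xi,\eta)\in\mathcal{F}\}$, $\mathcal{F}^n$ is the $n$-fold iterate, $\mathsf{Invset}^+(\mathcal{F})=\{\mathcal{U}\subset\mathcal{X}\mid\mathcal{F}(\mathcal{U})\subset\mathcal{U}\}$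 (a sublattice of $\mathsf{Set}(\mathcal{X})$), $\boldsymbol{\omega}(\mathcal{U})=\bigcap_{k\ge0}\bigcup_{n\ge k}\mathcal{F}^n(\mathcal{U})$, $\mathsf{Att}(\mathcal{F})=\{\mathcal{A}\subset\mathcal{X}\mid\mathcal{F}(\mathcal{A})=\mathcal{A}\}$ with join $\cup$ and meet $\boldsymbol{\omega}(\mathcal{A}\cap\mathcal{A}')$. $\Gamma^+(\xi)=\bigcup_{n\ge0}\mathcal{F}^n(\{\xi\})$ is the complete forward image of $\xi$ (including $\xi$). A single element $\xi$ is identified with $\{\xi\}$ in $|\xi|$ and $\boldsymbol{\omega}(\xi)$. The maps $\omega\colon\mathsf{ABlock}_{\mathscr{R}}(\varphi)\to\mathsf{Att}(\varphi)$ and $\boldsymbol{\omega}\colon\mathsf{Invset}^+(\mathcal{F})\to\mathsf{Att}(\mathcal{F})$ are surjective lattice homomorphisms. *)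

theory Defs
  imports "HOL-Analysis.Analysis"
begin

record 'a blat =
  carrier :: "'a set"
  join :: "'a \<Rightarrow> 'a \<Rightarrow> 'a"
  meet :: "'a \<Rightarrow> 'a \<Rightarrow> 'a"
  zero :: 'a
  one :: 'a

definition blat_hom :: "'a blat \<Rightarrow> 'b blat \<Rightarrow> ('a \<Rightarrow> 'b) \<Rightarrow> bool" where
  "blat_hom L M f \<longleftrightarrow>
     (\<forall>a \<in> carrier L. f a \<in> carrier M) \<and>
     (\<forall>a \<in> carrier L. \<forall>b \<in> carrier L. f (join L a b) = join M (f a) (f b)) \<and>
     (\<forall>a \<in> carrier L. \<forall>b \<in> carrier L. f (meet L a b) = meet M (f a) (f b)) \<and>
     f (zero L) = zero M \<and> f (one L) = one M"

definition Set_lat :: "'c set blat" where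
  "Set_lat = \<lparr>carrier = UNIV, join = (\<union>), meet = (\<inter>), zero = {}, one = UNIV\<rparr>"

definition regular_closed :: "'a::topological_space set \<Rightarrow> bool" where
  "regular_closed U \<longleftrightarrow> U = closure (interior U)"

definition RC_lat :: "'a::topological_space set blat" where
  "RC_lat = \<lparr>carrier = {U. regular_closed U}, join = (\<union>),
             meet = (\<lambda>U V. closure (interior (U \<inter> V))), zero = {}, one = UNIV\<rparr>"

text \<open>
  The time group is a subset \<open>T\<close> of the reals, either the integers or all of them.
  As the integers are discrete in the reals, joint continuity on \<open>T\<^sup>+ \<times> X\<close> is the
  right notion in both cases. Values \<open>\<phi> t x\<close> with \<open>t \<notin> T\<^sup>+\<close> are never used.
  The phase space is the whole type.
\<close>

definition time_group :: "real set \<Rightarrow> bool" where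
  "time_group T \<longleftrightarrow> T = \<int> \<or> T = UNIV"

definition nonneg_times :: "real set \<Rightarrow> real set" where
  "nonneg_times T = {t \<in> T. 0 \<le> t}"

definition dynamical_system ::
    "real set \<Rightarrow> (real \<Rightarrow> 'a::metric_space \<Rightarrow> 'a) \<Rightarrow> bool" where
  "dynamical_system T \<phi> \<longleftrightarrow>
     time_group T \<and>
     continuous_on (nonneg_times T \<times> UNIV) (\<lambda>(t, x). \<phi> t x) \<and>
     (\<forall>x. \<phi> 0 x = x) \<and>
     (\<forall>t \<in> nonneg_times T. \<forall>s \<in> nonneg_times T. \<forall>x. \<phi> t (\<phi> s x) = \<phi> (t + s) x)"

definition omega_limit ::
    "real set \<Rightarrow> (real \<Rightarrow> 'a::metric_space \<Rightarrow> 'a) \<Rightarrow> 'a set \<Rightarrow> 'a set" where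
  "omega_limit T \<phi> U =
     (\<Inter>t \<in> nonneg_times T. closure (\<Union>s \<in> {s \<in> T. t \<le> s}. \<phi> s ` U))"

definition attracting_block ::
    "real set \<Rightarrow> (real \<Rightarrow> 'a::metric_space \<Rightarrow> 'a) \<Rightarrow> 'a set \<Rightarrow> bool" where
  "attracting_block T \<phi> U \<longleftrightarrow> (\<forall>t \<in> T. 0 < t \<longrightarrow> \<phi> t ` closure U \<subseteq> interior U)"

definition ABlock_R ::
    "real set \<Rightarrow> (real \<Rightarrow> 'a::metric_space \<Rightarrow> 'a) \<Rightarrow> 'a set set" where
  "ABlock_R T \<phi> = {U. regular_closed U \<and> attracting_block T \<phi> U}"

definition attractor ::
    "real set \<Rightarrow> (real \<Rightarrow> 'a::metric_space \<Rightarrow> 'a) \<Rightarrow> 'a set \<Rightarrow> bool" where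
  "attractor T \<phi> A \<longleftrightarrow> (\<exists>U. open U \<and> A \<subseteq> U \<and> omega_limit T \<phi> U = A)"

definition Att_lat ::
    "real set \<Rightarrow> (real \<Rightarrow> 'a::metric_space \<Rightarrow> 'a) \<Rightarrow> 'a set blat" where
  "Att_lat T \<phi> =
     \<lparr>carrier = {A. attractor T \<phi> A}, join = (\<union>),
      meet = (\<lambda>A B. omega_limit T \<phi> (A \<inter> B)), zero = {}, one = omega_limit T \<phi> UNIV\<rparr>"

text \<open>The image of \<open>\<U>\<close> under \<open>F\<close> is \<open>F `` \<U>\<close>; under the \<open>n\<close>-fold iterate, \<open>(F ^^ n) `` \<U>\<close>.\<close>

definition Invset_plus :: "('c \<times> 'c) set \<Rightarrow> 'c set set" where
  "Invset_plus F = {\<U>. F `` \<U> \<subseteq> \<U>}"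

definition omega_rel :: "('c \<times> 'c) set \<Rightarrow> 'c set \<Rightarrow> 'c set" where
  "omega_rel F \<U> = (\<Inter>k. \<Union>n \<in> {k..}. (F ^^ n) `` \<U>)"

definition forward_image :: "('c \<times> 'c) set \<Rightarrow> 'c \<Rightarrow> 'c set" where
  "forward_image F \<xi> = (\<Union>n. (F ^^ n) `` {\<xi>})"

definition Att_rel_lat :: "('c \<times> 'c) set \<Rightarrow> 'c set blat" where
  "Att_rel_lat F =
     \<lparr>carrier = {\<A>. F `` \<A> = \<A>}, join = (\<union>),
      meet = (\<lambda>\<A> \<B>. omega_rel F (\<A> \<inter> \<B>)), zero = {}, one = omega_rel F UNIV\<rparr>"

text \<open>
  \<open>v\<close> is the evaluation map written \<open>|\<cdot>|\<close>. Once \<open>v\<close> maps \<open>Invset_plus F\<close> into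
  \<open>ABlock_R T \<phi>\<close>, its restriction is automatically a lattice homomorphism, since both
  are sublattices.
\<close>

definition diagram_commutes ::
    "real set \<Rightarrow> (real \<Rightarrow> 'a::metric_space \<Rightarrow> 'a) \<Rightarrow> ('c set \<Rightarrow> 'a set) \<Rightarrow> ('c \<times> 'c) set
      \<Rightarrow> ('c set \<Rightarrow> 'a set) \<Rightarrow> bool" where
  "diagram_commutes T \<phi> v F c \<longleftrightarrow>
     (\<forall>\<U> \<in> Invset_plus F. v \<U> \<in> ABlock_R T \<phi>) \<and>
     blat_hom (Att_rel_lat F) (Att_lat T \<phi>) c \<and>
     (\<forall>\<U> \<in> Invset_plus F. c (omega_rel F \<U>) = omega_limit T \<phi> (v \<U>))"

end

theory Submission
  imports Defs
begin

text \<open>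
  For a compact forward invariant set \<open>V\<close> one has \<open>\<omega>(V) = \<Inter>\<^sub>t \<phi>\<^sub>t(V)\<close>, so \<open>\<omega>(V)\<close> is
  invariant and \<open>\<omega>(\<omega>(V)) = \<omega>(V)\<close>; combinatorially, \<open>\<omega>(\<U>) = \<Inter>\<^sub>n F\<^sup>n(\<U>)\<close> for
  forward invariant \<open>\<U>\<close>, a decreasing sequence that is eventually constant.
  Given (W), forward invariant sets evaluate to attracting blocks because \<open>v\<close> is additive;
  given (L), \<open>\<omega>(v(\<U>)) \<subseteq> v(\<omega>(\<U>))\<close>, and applying \<open>\<omega>\<close> once more yields
  \<open>\<omega>(v(\<U>)) = \<omega>(v(\<omega>(\<U>)))\<close>, which makes \<open>c = \<omega> \<circ> v\<close> a homomorphism.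
  Conversely, (W) and (L) follow by evaluating the diagram on the forward image of a point,
  which has the same limit set as the point.
\<close>

section \<open>Limit sets of relations\<close>

lemma relpow_add_Image: "(F ^^ (m + n)) `` U = (F ^^ n) `` ((F ^^ m) `` U)"
  by (simp add: relpow_add relcomp_Image)

lemma relpow_Image_eq:
  assumes "F `` A = A" shows "(F ^^ n) `` A = A"
  by (induction n) (simp_all add: relcomp_Image assms)

lemma relpow_Image_decreasing:
  assumes "F `` U \<subseteq> U" and "m \<le> n"
  shows "(F ^^ n) `` U \<subseteq> (F ^^ m) `` U"
proof -
  have inv: "(F ^^ k) `` U \<subseteq> U" for k
    using assms(1) by (induction k) (auto simp: relcomp_Image)
  obtain k where "n = k + m" using assms(2) by (metis add.commute le_Suc_ex)
  then show ?thesis using inv[of k] by (auto simp: relpow_add_Image simp del: relpow.simps)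
qed

lemma omega_rel_mono: "U \<subseteq> V \<Longrightarrow> omega_rel F U \<subseteq> omega_rel F V"
  unfolding omega_rel_def by blast

text \<open>The images of a forward invariant set decrease, so each tail union collapses to its
  first term.\<close>

lemma omega_rel_eq_INT:
  assumes "F `` U \<subseteq> U"
  shows "omega_rel F U = (\<Inter>n. (F ^^ n) `` U)"
proof -
  have "(\<Union>n\<in>{k..}. (F ^^ n) `` U) = (F ^^ k) `` U" for k
    using relpow_Image_decreasing[OF assms] by fastforce
  then show ?thesis unfolding omega_rel_def by simp
qed

lemma omega_rel_subset: "F `` U \<subseteq> U \<Longrightarrow> omega_rel F U \<subseteq> U"
  using INT_lower[of 0 UNIV "\<lambda>n. (F ^^ n) `` U"] by (simp add: omega_rel_eq_INT)

lemma omega_rel_fixed: "F `` A = A \<Longrightarrow> omega_rel F A = A"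
  by (simp add: omega_rel_eq_INT relpow_Image_eq)

lemma Image_omega_rel:
  fixes U :: "'c::finite set"
  assumes "F `` U \<subseteq> U"
  shows "F `` omega_rel F U = omega_rel F U"
proof -
  \<comment> \<open>\<open>N\<close> minimizes the cardinality of the images. Later images are
    subsets of the \<open>N\<close>-th one and no smaller, so by finiteness they equal it.\<close>
  obtain N where N: "\<And>n. card ((F ^^ N) `` U) \<le> card ((F ^^ n) `` U)"
    using ex_has_least_nat[of "\<lambda>_. True" _ "\<lambda>n. card ((F ^^ n) `` U)"] by auto
  have stable: "(F ^^ n) `` U = (F ^^ N) `` U" if "N \<le> n" for n
    using relpow_Image_decreasing[OF assms that] N[of n]
    by (simp add: card_seteq)
  have "(F ^^ N) `` U \<subseteq> (F ^^ n) `` U" for n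
    using stable[of n] relpow_Image_decreasing[OF assms, of n N] by fastforce
  then have eq: "omega_rel F U = (F ^^ N) `` U"
    unfolding omega_rel_eq_INT[OF assms] by blast
  have "F `` ((F ^^ N) `` U) = (F ^^ Suc N) `` U"
    by (simp add: relcomp_Image)
  then show ?thesis unfolding eq using stable[of "Suc N"] by simp
qed

lemma forward_image_refl: "\<xi> \<in> forward_image F \<xi>"
  unfolding forward_image_def using relpow_0_I[of \<xi> F] by blast

lemma Image_forward_image: "F `` forward_image F \<xi> \<subseteq> forward_image F \<xi>"
  unfolding forward_image_def using relpow_Suc_I[of \<xi>] by blast

lemma forward_image_subset:
  assumes "F `` U \<subseteq> U" and "\<xi> \<in> U"
  shows "forward_image F \<xi> \<subseteq> U"
proof -
  have "(F ^^ n) `` {\<xi>} \<subseteq> (F ^^ 0) `` U" for n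
    using relpow_Image_decreasing[OF assms(1), of 0 n] assms(2) by blast
  then show ?thesis unfolding forward_image_def by auto
qed

text \<open>The \<open>k\<close>-th image of the forward image is exactly the \<open>k\<close>-th
  tail union of the images of the point. This lets conditions on a point be tested on a forward
  invariant set.\<close>

lemma omega_rel_forward_image:
  "omega_rel F (forward_image F \<xi>) = omega_rel F {\<xi>}"
proof -
  have "(F ^^ k) `` forward_image F \<xi> = (\<Union>n\<in>{k..}. (F ^^ n) `` {\<xi>})" for k
  proof -
    have "(F ^^ k) `` forward_image F \<xi> = (\<Union>m. (F ^^ (m + k)) `` {\<xi>})"
      unfolding forward_image_def by (simp add: Image_UN relpow_add_Image)
    also have "\<dots> = (\<Union>n\<in>range (\<lambda>m. m + k). (F ^^ n) `` {\<xi>})" by simp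
    also have "range (\<lambda>m. m + k) = {k..}"
      by (auto simp: image_iff intro: le_add_diff_inverse2[symmetric])
    finally show ?thesis .
  qed
  then show ?thesis
    by (simp add: omega_rel_eq_INT[OF Image_forward_image]) (simp add: omega_rel_def)
qed

section \<open>Limit sets of dynamical systems\<close>

lemma regular_closed_imp_closed: "regular_closed U \<Longrightarrow> closed U"
  unfolding regular_closed_def by (metis closed_closure)

lemma omega_limit_mono: "U \<subseteq> V \<Longrightarrow> omega_limit T \<phi> U \<subseteq> omega_limit T \<phi> V"
  unfolding omega_limit_def by (intro INF_mono' closure_mono UN_mono image_mono) auto

locale compact_system =
  fixes T :: "real set" and \<phi> :: "real \<Rightarrow> 'a::metric_space \<Rightarrow> 'a"
  assumes compact_UNIV: "compact (UNIV :: 'a set)"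
    and system: "dynamical_system T \<phi>"
begin

abbreviation forward_invariant :: "'a set \<Rightarrow> bool" where
  "forward_invariant V \<equiv> \<forall>t\<in>nonneg_times T. \<phi> t ` V \<subseteq> V"

section \<open>Times and flow maps\<close>

lemma zero_time: "0 \<in> nonneg_times T"
  and one_time: "1 \<in> nonneg_times T"
  and add_times: "s \<in> nonneg_times T \<Longrightarrow> t \<in> nonneg_times T \<Longrightarrow> s + t \<in> nonneg_times T"
  and diff_times: "s \<in> T \<Longrightarrow> t \<in> nonneg_times T \<Longrightarrow> t \<le> s \<Longrightarrow> s - t \<in> nonneg_times T"
  using system unfolding dynamical_system_def time_group_def nonneg_times_def by auto

lemma flow_zero: "\<phi> 0 x = x"
  using system unfolding dynamical_system_def by blast

lemma flow_add:
  "s \<in> nonneg_times T \<Longrightarrow> t \<in> nonneg_times T \<Longrightarrow> \<phi> (s + t) ` V = \<phi> s ` (\<phi> t ` V)"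
  using system unfolding dynamical_system_def image_image by simp

lemma continuous_flow: "t \<in> nonneg_times T \<Longrightarrow> continuous_on S (\<phi> t)"
proof -
  assume t: "t \<in> nonneg_times T"
  have "continuous_on (nonneg_times T \<times> UNIV) (\<lambda>(t, x). \<phi> t x)"
    using system unfolding dynamical_system_def by blast
  then have "continuous_on S (\<lambda>x. case (t, x) of (t, x) \<Rightarrow> \<phi> t x)"
    by (rule continuous_on_compose2) (use t in \<open>auto intro!: continuous_intros\<close>)
  then show ?thesis by simp
qed

lemma closed_imp_compact: "closed (V :: 'a set) \<Longrightarrow> compact V"
  using compact_UNIV closed_Int_compact[of V UNIV] by simp

lemma closed_flow_image: "closed V \<Longrightarrow> t \<in> nonneg_times T \<Longrightarrow> closed (\<phi> t ` V)"
  by (simp add: closed_imp_compact compact_continuous_image compact_imp_closed continuous_flow)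

lemma omega_limit_empty: "omega_limit T \<phi> {} = {}"
  unfolding omega_limit_def using zero_time by auto

text \<open>Closure commutes with binary unions, and the tails decrease in time: a point missed by a
  tail of \<open>U\<close> and by a tail of \<open>V\<close> is missed by both at the later of the
  two times.\<close>

lemma omega_limit_Un: "omega_limit T \<phi> (U \<union> V) = omega_limit T \<phi> U \<union> omega_limit T \<phi> V"
proof
  let ?K = "\<lambda>W t. closure (\<Union>s\<in>{s \<in> T. t \<le> s}. \<phi> s ` W)"
  have dec: "?K W t \<subseteq> ?K W s" if "s \<le> t" for W s t
    using that by (intro closure_mono) fastforce
  have Un: "?K (U \<union> V) t = ?K U t \<union> ?K V t" for t
    by (simp only: closure_Un[symmetric] image_Un UN_Un_distrib)
  show "omega_limit T \<phi> (U \<union> V) \<subseteq> omega_limit T \<phi> U \<union> omega_limit T \<phi> V"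
  proof
    fix x assume x: "x \<in> omega_limit T \<phi> (U \<union> V)"
    show "x \<in> omega_limit T \<phi> U \<union> omega_limit T \<phi> V"
    proof (rule ccontr)
      assume "\<not> ?thesis"
      then obtain s t where s: "s \<in> nonneg_times T" "x \<notin> ?K U s"
        and t: "t \<in> nonneg_times T" "x \<notin> ?K V t"
        unfolding omega_limit_def by blast
      have "max s t \<in> nonneg_times T" using s t by (simp add: max_def)
      then have "x \<in> ?K U (max s t) \<union> ?K V (max s t)"
        using x Un unfolding omega_limit_def by blast
      then show False using s(2) t(2) dec[of s "max s t" U] dec[of t "max s t" V] by auto
    qed
  qed
qed (simp add: omega_limit_mono)

lemma omega_limit_UN:
  "finite I \<Longrightarrow> omega_limit T \<phi> (\<Union>i\<in>I. V i) = (\<Union>i\<in>I. omega_limit T \<phi> (V i))"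
  by (induction I rule: finite_induct) (simp_all add: omega_limit_empty omega_limit_Un)

text \<open>For \<open>t \<le> s\<close> the image at time \<open>s\<close> is the
  time-\<open>t\<close> image of a subset of \<open>V\<close>, so the tail from \<open>t\<close> is
  just the image at \<open>t\<close>. That image is compact, hence already closed.\<close>

lemma omega_limit_eq_INT:
  assumes "closed V" and "forward_invariant V"
  shows "omega_limit T \<phi> V = (\<Inter>t\<in>nonneg_times T. \<phi> t ` V)"
proof -
  have "closure (\<Union>s\<in>{s \<in> T. t \<le> s}. \<phi> s ` V) = \<phi> t ` V" if t: "t \<in> nonneg_times T" for t
  proof -
    have "\<phi> s ` V \<subseteq> \<phi> t ` V" if "s \<in> T" "t \<le> s" for s
    proof -
      have d: "s - t \<in> nonneg_times T" using diff_times t that by blast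
      then have "\<phi> s ` V = \<phi> t ` (\<phi> (s - t) ` V)" using flow_add[OF t d] by simp
      then show ?thesis using assms(2) d by (metis image_mono)
    qed
    then have "(\<Union>s\<in>{s \<in> T. t \<le> s}. \<phi> s ` V) = \<phi> t ` V"
      using t unfolding nonneg_times_def by blast
    then show ?thesis using closed_flow_image[OF assms(1) t] by simp
  qed
  then show ?thesis unfolding omega_limit_def by simp
qed

text \<open>Each image of \<open>V\<close> contains a preimage of \<open>y\<close> under
  \<open>\<phi> t\<close>, but the preimage may vary with the image. Compactness supplies a single
  one lying in all images.\<close>

lemma omega_limit_subset_flow:
  assumes V: "closed V" "forward_invariant V" and t: "t \<in> nonneg_times T"
  shows "omega_limit T \<phi> V \<subseteq> \<phi> t ` omega_limit T \<phi> V"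
proof
  fix y assume "y \<in> omega_limit T \<phi> V"
  then have y: "y \<in> \<phi> s ` V" if "s \<in> nonneg_times T" for s
    using that omega_limit_eq_INT[OF V] by blast
  define K where "K = (\<lambda>s. \<phi> s ` V \<inter> \<phi> t -` {y})"
  have "UNIV \<inter> \<Inter> (K ` nonneg_times T) \<noteq> {}"
  proof (rule compact_imp_fip[OF compact_UNIV])
    fix A assume "A \<in> K ` nonneg_times T"
    then obtain s where s: "s \<in> nonneg_times T" and A: "A = K s" by blast
    have "closed (\<phi> t -` {y})"
      using continuous_flow[OF t] by (intro closed_vimage) simp_all
    then show "closed A"
      unfolding A K_def by (intro closed_Int closed_flow_image[OF V(1) s])
  next
    fix \<A> assume "finite \<A>" "\<A> \<subseteq> K ` nonneg_times T"
    then obtain S where S: "finite S" "S \<subseteq> nonneg_times T" "\<A> = K ` S"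
      by (meson finite_subset_image)
    \<comment> \<open>The images of \<open>V\<close> decrease in time, so a preimage found at the
      latest time serves all of \<open>S\<close>. Inserting 0 keeps \<open>Max\<close> meaningful
      for empty \<open>S\<close>.\<close>
    define m where "m = Max (insert 0 S)"
    have m: "m \<in> nonneg_times T"
      using Max_in[of "insert 0 S"] S zero_time unfolding m_def by auto
    obtain x where x: "x \<in> \<phi> m ` V" "\<phi> t x = y"
    proof -
      have "y \<in> \<phi> t ` (\<phi> m ` V)"
        using y[OF add_times[OF t m]] by (simp only: flow_add[OF t m])
      then show ?thesis using that by blast
    qed
    have "x \<in> K s" if "s \<in> S" for s
    proof -
      have s: "s \<in> nonneg_times T" using S that by blast
      have "s \<le> m" using S that unfolding m_def by simp
      then have d: "m - s \<in> nonneg_times T"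
        using diff_times m s unfolding nonneg_times_def by blast
      have "\<phi> m ` V = \<phi> s ` (\<phi> (m - s) ` V)" using flow_add[OF s d] by simp
      then have "\<phi> m ` V \<subseteq> \<phi> s ` V" using V(2) d by (metis image_mono)
      then show ?thesis using x unfolding K_def by blast
    qed
    then show "UNIV \<inter> \<Inter> \<A> \<noteq> {}" using S by auto
  qed
  then obtain x where x: "x \<in> K s" if "s \<in> nonneg_times T" for s by blast
  have "x \<in> omega_limit T \<phi> V"
    unfolding omega_limit_eq_INT[OF V] using x unfolding K_def by blast
  moreover have "\<phi> t x = y" using x[OF zero_time] unfolding K_def by blast
  ultimately show "y \<in> \<phi> t ` omega_limit T \<phi> V" by blast
qed

text \<open>One inclusion holds because the limit set lies in \<open>V\<close>. For the other, the
  limit set is covered by its own image at time \<open>t\<close>, which is a member of the tail from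
  \<open>t\<close>.\<close>

lemma omega_limit_idem:
  assumes V: "closed V" "forward_invariant V"
  shows "omega_limit T \<phi> (omega_limit T \<phi> V) = omega_limit T \<phi> V"
proof
  have "omega_limit T \<phi> V \<subseteq> \<phi> 0 ` V"
    unfolding omega_limit_eq_INT[OF V] using zero_time by blast
  then show "omega_limit T \<phi> (omega_limit T \<phi> V) \<subseteq> omega_limit T \<phi> V"
    by (intro omega_limit_mono) (simp add: flow_zero)
  have "omega_limit T \<phi> V \<subseteq> closure (\<Union>s\<in>{s \<in> T. t \<le> s}. \<phi> s ` omega_limit T \<phi> V)"
    if "t \<in> nonneg_times T" for t
  proof -
    have "t \<in> {s \<in> T. t \<le> s}" using that unfolding nonneg_times_def by simp
    then have "\<phi> t ` omega_limit T \<phi> V \<subseteq> (\<Union>s\<in>{s \<in> T. t \<le> s}. \<phi> s ` omega_limit T \<phi> V)"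
      by blast
    then show ?thesis using omega_limit_subset_flow[OF V that] closure_subset by blast
  qed
  then show "omega_limit T \<phi> V \<subseteq> omega_limit T \<phi> (omega_limit T \<phi> V)"
    by (subst (2) omega_limit_def) blast
qed

section \<open>Limit sets of attracting blocks\<close>

lemma block_forward_invariant:
  assumes "V \<in> ABlock_R T \<phi>"
  shows "closed V" and "forward_invariant V"
proof -
  have block: "\<phi> t ` closure V \<subseteq> interior V" if "t \<in> T" "0 < t" for t
    using assms that unfolding ABlock_R_def attracting_block_def by blast
  show "closed V"
    using assms by (simp add: ABlock_R_def regular_closed_imp_closed)
  show "forward_invariant V"
  proof
    fix t assume t: "t \<in> nonneg_times T"
    show "\<phi> t ` V \<subseteq> V"
    proof (cases "t = 0")
      case True
      then show ?thesis by (simp add: flow_zero)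
    next
      case False
      then have "\<phi> t ` closure V \<subseteq> interior V"
        using block t unfolding nonneg_times_def by simp
      then show ?thesis using closure_subset interior_subset by blast
    qed
  qed
qed

lemma omega_limit_block_subset_interior:
  assumes "V \<in> ABlock_R T \<phi>"
  shows "omega_limit T \<phi> V \<subseteq> interior V"
proof -
  note V = block_forward_invariant[OF assms]
  \<comment> \<open>Any positive time would do; 1 is available for both the integers and the
    reals.\<close>
  have "omega_limit T \<phi> V \<subseteq> \<phi> 1 ` V"
    unfolding omega_limit_eq_INT[OF V] using one_time by blast
  also have "\<dots> \<subseteq> interior V"
    using assms one_time closure_subset[of V]
    unfolding ABlock_R_def attracting_block_def nonneg_times_def by fastforce
  finally show ?thesis .
qed

text \<open>The interior is squeezed between the limit set and the block, and taking limit sets of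
  these two gives the same result by idempotence. Thus the interior is the open neighborhood that
  the definition of \<open>attractor\<close> asks for.\<close>

lemma omega_limit_interior_block:
  assumes "V \<in> ABlock_R T \<phi>"
  shows "omega_limit T \<phi> (interior V) = omega_limit T \<phi> V"
  using omega_limit_mono[OF omega_limit_block_subset_interior[OF assms], of T \<phi>]
    omega_limit_mono[OF interior_subset, of T \<phi> V]
    omega_limit_idem[OF block_forward_invariant[OF assms]] by blast

lemma attractor_omega_limit_block:
  "V \<in> ABlock_R T \<phi> \<Longrightarrow> attractor T \<phi> (omega_limit T \<phi> V)"
  unfolding attractor_def
  using omega_limit_interior_block omega_limit_block_subset_interior open_interior by blast

lemma omega_limit_meet:
  assumes U: "U \<in> ABlock_R T \<phi>" and V: "V \<in> ABlock_R T \<phi>"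
    and UV: "closure (interior (U \<inter> V)) \<in> ABlock_R T \<phi>"
  shows "omega_limit T \<phi> (closure (interior (U \<inter> V)))
       = omega_limit T \<phi> (omega_limit T \<phi> U \<inter> omega_limit T \<phi> V)" (is "omega_limit T \<phi> ?W = _")
proof
  have "closed (U \<inter> V)" using block_forward_invariant[OF U] block_forward_invariant[OF V] by blast
  then have "?W \<subseteq> U \<inter> V" by (intro closure_minimal interior_subset)
  then have "omega_limit T \<phi> ?W \<subseteq> omega_limit T \<phi> U \<inter> omega_limit T \<phi> V"
    by (simp add: omega_limit_mono)
  then show "omega_limit T \<phi> ?W \<subseteq> omega_limit T \<phi> (omega_limit T \<phi> U \<inter> omega_limit T \<phi> V)"
    by (metis omega_limit_mono omega_limit_idem block_forward_invariant[OF UV])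
  \<comment> \<open>The regularized meet may lose points of \<open>U \<inter> V\<close>, but none of
    its interior; hence the limit sets must be placed in the interiors of the blocks.\<close>
  have "omega_limit T \<phi> U \<inter> omega_limit T \<phi> V \<subseteq> interior (U \<inter> V)"
    using omega_limit_block_subset_interior[OF U] omega_limit_block_subset_interior[OF V]
    by (auto simp: interior_Int)
  then show "omega_limit T \<phi> (omega_limit T \<phi> U \<inter> omega_limit T \<phi> V) \<subseteq> omega_limit T \<phi> ?W"
    by (meson omega_limit_mono closure_subset subset_trans)
qed

end

section \<open>Evaluation homomorphisms\<close>

lemma
  assumes "blat_hom Set_lat RC_lat v"
  shows eval_regular_closed: "regular_closed (v U)"
    and eval_Un: "v (U \<union> V) = v U \<union> v V"
    and eval_Int: "v (U \<inter> V) = closure (interior (v U \<inter> v V))"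
    and eval_empty: "v {} = {}"
    and eval_UNIV: "v UNIV = UNIV"
  using assms unfolding blat_hom_def Set_lat_def RC_lat_def by auto

lemma eval_mono:
  assumes "blat_hom Set_lat RC_lat v" and "U \<subseteq> V"
  shows "v U \<subseteq> v V"
  using eval_Un[OF assms(1), of U V] assms(2) by (metis Un_upper1 subset_Un_eq)

text \<open>Evaluation is determined by its values on singletons; this is how the pointwise
  conditions (W) and (L) reach arbitrary sets.\<close>

lemma eval_eq_UN:
  assumes "blat_hom Set_lat RC_lat v" and "finite U"
  shows "v U = (\<Union>\<xi>\<in>U. v {\<xi>})"
  using assms(2)
proof (induction U rule: finite_induct)
  case empty
  then show ?case by (simp add: eval_empty[OF assms(1)])
next
  case (insert \<xi> U)
  then show ?case using eval_Un[OF assms(1), of "{\<xi>}" U] by simp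
qed

section \<open>Commutativity of the diagram\<close>

locale evaluated_relation = compact_system T \<phi>
  for T :: "real set" and \<phi> :: "real \<Rightarrow> 'a::metric_space \<Rightarrow> 'a" +
  fixes v :: "'c::finite set \<Rightarrow> 'a set" and F :: "('c \<times> 'c) set"
  assumes eval: "blat_hom Set_lat RC_lat v"
begin

text \<open>An attractor of \<open>F\<close> is forward invariant and its own limit set, so
  commutativity at \<open>A\<close> itself leaves no choice for \<open>c A\<close>.\<close>

lemma commuting_map_unique:
  assumes "diagram_commutes T \<phi> v F c" and "F `` A = A"
  shows "c A = omega_limit T \<phi> (v A)"
proof -
  have "A \<in> Invset_plus F" using assms(2) by (simp add: Invset_plus_def)
  then have "c (omega_rel F A) = omega_limit T \<phi> (v A)"
    using assms(1) unfolding diagram_commutes_def by blast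
  then show ?thesis by (simp add: omega_rel_fixed assms(2))
qed

section \<open>Necessity of (W) and (L)\<close>

lemma commutes_imp_W:
  assumes "diagram_commutes T \<phi> v F c" and "t \<in> T" and "0 < t"
  shows "\<phi> t ` v {\<xi>} \<subseteq> interior (v (forward_image F \<xi>))"
proof -
  have "v (forward_image F \<xi>) \<in> ABlock_R T \<phi>"
    using assms(1) Image_forward_image[of F \<xi>]
    unfolding diagram_commutes_def Invset_plus_def by blast
  then have "\<phi> t ` closure (v (forward_image F \<xi>)) \<subseteq> interior (v (forward_image F \<xi>))"
    using assms(2,3) unfolding ABlock_R_def attracting_block_def by blast
  moreover have "v {\<xi>} \<subseteq> closure (v (forward_image F \<xi>))"
    using eval_mono[OF eval, of "{\<xi>}" "forward_image F \<xi>"] forward_image_refl closure_subset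
    by fastforce
  ultimately show ?thesis by blast
qed

lemma commutes_imp_L:
  assumes "diagram_commutes T \<phi> v F c"
  shows "omega_limit T \<phi> (v {\<xi>}) \<subseteq> v (omega_rel F {\<xi>})"
proof -
  let ?G = "forward_image F \<xi>" and ?A = "omega_rel F {\<xi>}"
  have G: "F `` ?G \<subseteq> ?G" by (rule Image_forward_image)
  have A: "F `` ?A = ?A"
    using Image_omega_rel[OF G] by (simp add: omega_rel_forward_image)
  \<comment> \<open>Commutativity is used at two forward invariant sets with the same limit set,
    \<open>?G\<close> and \<open>?A\<close>. As \<open>v ?A\<close> is a block, it contains its own
    limit set.\<close>
  have block: "v ?A \<in> ABlock_R T \<phi>"
    using assms A unfolding diagram_commutes_def Invset_plus_def by blast
  have "omega_limit T \<phi> (v {\<xi>}) \<subseteq> omega_limit T \<phi> (v ?G)"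
    using forward_image_refl by (intro omega_limit_mono eval_mono[OF eval]) auto
  also have "\<dots> = c ?A"
  proof -
    have "?G \<in> Invset_plus F" using G by (simp add: Invset_plus_def)
    then have "c (omega_rel F ?G) = omega_limit T \<phi> (v ?G)"
      using assms unfolding diagram_commutes_def by blast
    then show ?thesis by (simp add: omega_rel_forward_image)
  qed
  also have "\<dots> = omega_limit T \<phi> (v ?A)"
    by (rule commuting_map_unique[OF assms A])
  also have "\<dots> \<subseteq> v ?A"
    using omega_limit_block_subset_interior[OF block] interior_subset by blast
  finally show ?thesis .
qed

section \<open>Sufficiency of (W) and (L)\<close>

lemma W_imp_block:
  assumes W: "\<And>\<xi> t. t \<in> T \<Longrightarrow> 0 < t \<Longrightarrow> \<phi> t ` v {\<xi>} \<subseteq> interior (v (forward_image F \<xi>))"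
    and U: "F `` U \<subseteq> U"
  shows "v U \<in> ABlock_R T \<phi>"
proof -
  have rc: "regular_closed (v U)" by (rule eval_regular_closed[OF eval])
  then have "closed (v U)" by (rule regular_closed_imp_closed)
  moreover have "\<phi> t ` v U \<subseteq> interior (v U)" if "t \<in> T" "0 < t" for t
  proof -
    \<comment> \<open>A forward invariant \<open>U\<close> contains the forward images of its
      points, so (W) and monotonicity give the bound.\<close>
    have "\<phi> t ` v {\<xi>} \<subseteq> interior (v U)" if "\<xi> \<in> U" for \<xi>
      using W[OF \<open>t \<in> T\<close> \<open>0 < t\<close>, of \<xi>]
        interior_mono[OF eval_mono[OF eval forward_image_subset[OF U that]]] by blast
    then show ?thesis using eval_eq_UN[OF eval, of U] by auto
  qed
  ultimately show ?thesis using rc unfolding ABlock_R_def attracting_block_def by simp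
qed

lemma L_imp_omega_limit_eq:
  assumes L: "\<And>\<xi>. omega_limit T \<phi> (v {\<xi>}) \<subseteq> v (omega_rel F {\<xi>})"
    and U: "F `` U \<subseteq> U" and block: "v U \<in> ABlock_R T \<phi>"
  shows "omega_limit T \<phi> (v (omega_rel F U)) = omega_limit T \<phi> (v U)"
proof
  show "omega_limit T \<phi> (v (omega_rel F U)) \<subseteq> omega_limit T \<phi> (v U)"
    by (intro omega_limit_mono eval_mono[OF eval] omega_rel_subset U)
  have "omega_limit T \<phi> (v U) = (\<Union>\<xi>\<in>U. omega_limit T \<phi> (v {\<xi>}))"
    by (subst eval_eq_UN[OF eval]) (simp_all add: omega_limit_UN)
  also have "\<dots> \<subseteq> (\<Union>\<xi>\<in>U. v (omega_rel F {\<xi>}))" using L by blast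
  also have "\<dots> \<subseteq> v (omega_rel F U)"
    by (intro UN_least eval_mono[OF eval] omega_rel_mono) simp
  \<comment> \<open>The bound by \<open>v (omega_rel F U)\<close> becomes a bound by its limit set
    after one more limit, which leaves the left side unchanged.\<close>
  finally have "omega_limit T \<phi> (omega_limit T \<phi> (v U)) \<subseteq> omega_limit T \<phi> (v (omega_rel F U))"
    by (rule omega_limit_mono)
  then show "omega_limit T \<phi> (v U) \<subseteq> omega_limit T \<phi> (v (omega_rel F U))"
    by (simp only: omega_limit_idem[OF block_forward_invariant[OF block]])
qed

lemma W_L_imp_commutes:
  assumes W: "\<And>\<xi> t. t \<in> T \<Longrightarrow> 0 < t \<Longrightarrow> \<phi> t ` v {\<xi>} \<subseteq> interior (v (forward_image F \<xi>))"
    and L: "\<And>\<xi>. omega_limit T \<phi> (v {\<xi>}) \<subseteq> v (omega_rel F {\<xi>})"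
  shows "diagram_commutes T \<phi> v F (\<lambda>A. omega_limit T \<phi> (v A))"
proof -
  have block: "v U \<in> ABlock_R T \<phi>" if "F `` U \<subseteq> U" for U
    using W_imp_block[OF W that] by blast
  have omega: "omega_limit T \<phi> (v (omega_rel F U)) = omega_limit T \<phi> (v U)" if "F `` U \<subseteq> U" for U
    using L_imp_omega_limit_eq[OF L that block[OF that]] by blast
  \<comment> \<open>The combinatorial meet is the limit set of \<open>A \<inter> B\<close>, which
    \<open>omega\<close> replaces by \<open>A \<inter> B\<close>; evaluating that gives the
    regularized meet of two blocks.\<close>
  have meet: "omega_limit T \<phi> (v (omega_rel F (A \<inter> B)))
      = omega_limit T \<phi> (omega_limit T \<phi> (v A) \<inter> omega_limit T \<phi> (v B))"
    if "F `` A = A" "F `` B = B" for A B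
  proof -
    have AB: "F `` (A \<inter> B) \<subseteq> A \<inter> B" using that by blast
    have "v A \<in> ABlock_R T \<phi>" "v B \<in> ABlock_R T \<phi>" using block that by auto
    then show ?thesis
      using omega_limit_meet block[OF AB] omega[OF AB] by (simp add: eval_Int[OF eval])
  qed
  \<comment> \<open>The top element is \<open>omega_rel F UNIV\<close>, so preserving it is the case
    \<open>UNIV\<close> of \<open>omega\<close> together with \<open>v UNIV = UNIV\<close>.\<close>
  have "blat_hom (Att_rel_lat F) (Att_lat T \<phi>) (\<lambda>A. omega_limit T \<phi> (v A))"
    unfolding blat_hom_def Att_rel_lat_def Att_lat_def
    using attractor_omega_limit_block block meet omega[of UNIV]
    by (simp add: eval_Un[OF eval] eval_empty[OF eval] eval_UNIV[OF eval]
        omega_limit_Un omega_limit_empty)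
  then show ?thesis
    unfolding diagram_commutes_def Invset_plus_def using block omega by blast
qed

end

theorem theorem9p6:
  fixes T :: "real set"
    and \<phi> :: "real \<Rightarrow> 'a::metric_space \<Rightarrow> 'a"
    and v :: "'c::finite set \<Rightarrow> 'a set"
    and F :: "('c \<times> 'c) set"
  assumes "compact (UNIV :: 'a set)"
    and "dynamical_system T \<phi>"
    and "blat_hom Set_lat RC_lat v"
  shows "((\<exists>c. diagram_commutes T \<phi> v F c) \<longleftrightarrow>
            (\<forall>\<xi>. \<forall>t \<in> T. 0 < t \<longrightarrow> \<phi> t ` v {\<xi>} \<subseteq> interior (v (forward_image F \<xi>))) \<and>
            (\<forall>\<xi>. omega_limit T \<phi> (v {\<xi>}) \<subseteq> v (omega_rel F {\<xi>}))) \<and>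
         (\<forall>c. diagram_commutes T \<phi> v F c \<longrightarrow>
            (\<forall>\<A> \<in> carrier (Att_rel_lat F). c \<A> = omega_limit T \<phi> (v \<A>)))"
proof -
  interpret evaluated_relation T \<phi> v F
    using assms by unfold_locales
  show ?thesis
  proof (intro conjI iffI; (elim exE conjE)?)
    fix c assume c: "diagram_commutes T \<phi> v F c"
    show "\<forall>\<xi>. \<forall>t\<in>T. 0 < t \<longrightarrow> \<phi> t ` v {\<xi>} \<subseteq> interior (v (forward_image F \<xi>))"
      by (intro allI ballI impI commutes_imp_W[OF c])
    show "\<forall>\<xi>. omega_limit T \<phi> (v {\<xi>}) \<subseteq> v (omega_rel F {\<xi>})"
      by (intro allI commutes_imp_L[OF c])
  next
    assume W: "\<forall>\<xi>. \<forall>t\<in>T. 0 < t \<longrightarrow> \<phi> t ` v {\<xi>} \<subseteq> interior (v (forward_image F \<xi>))"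
      and L: "\<forall>\<xi>. omega_limit T \<phi> (v {\<xi>}) \<subseteq> v (omega_rel F {\<xi>})"
    show "\<exists>c. diagram_commutes T \<phi> v F c"
      by (rule exI, rule W_L_imp_commutes) (use W L in simp_all)
  next
    show "\<forall>c. diagram_commutes T \<phi> v F c \<longrightarrow>
            (\<forall>\<A> \<in> carrier (Att_rel_lat F). c \<A> = omega_limit T \<phi> (v \<A>))"
      by (simp add: commuting_map_unique Att_rel_lat_def)
  qed
qed

end
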